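(* Let $R$ be a commutative ring with unity and let $M$ be an $R$-module with $\operatorname{Spec}(M)\neq\emptyset$. If inclusion $\subseteq$ is a connected relation on the set $\operatorname{Spec}(M)$ of prime submodules of $M$, then $\widetilde{\operatorname{Spec}(M)}$ is a connected space. In particular, the converse holds if $M$ is a multiplication module.
   Context: For a submodule $N$ of an $R$-module $M$, $(N:M)=\{r\in R : rM\subseteq N\}$. A proper submodule $P$ of $M$ is prime if whenever $rm\in P$ with $r\in R$, $m\in M$, then $m\in P$ or $r\in(P:M)$; in this case $(P:M)$ is a prime ideal of $R$. $\operatorname{Spec}(M)$ is the set of all prime submodules of $M$. A subset $T\subseteq R$ is multiplicatively closed if $1\in T$ and $xy\in T$ whenever $x,y\in T$. For a family $\mathcal{S}=\{S_i\}_{i\in I}$ of multiplicatively closed subsets of $R$, $\widetilde{V}(\mathcal{S})=\{P\in\operatorname{Spec}(M) \mid (P:M)\cap S_i\neq\emptyset \text{ for all } i\in I\}$. $\widetilde{\operatorname{Spec}(M)}$ denotes the set $\operatorname{Spec}(M)$ with the topology whose closed sets are exactly the sets $\widetilde{V}(\mathcal{S})$, $\mathcal{S}$ ranging over all families of multiplicatively closed subsets of $R$. A binary relation $\mathcal{R}$ on a set $X$ is a connected relation if for any $x,y\in X$ there exist elements $x_1,\dots,x_n$ of $X$ such that $x=x_1$, $y=x_n$ and, for all $2\le i\le n$, $x_{i-1}\,\mathcal{R}\,x_i$ or $x_i\,\mathcal{R}\,x_{i-1}$. $M$ is a multiplication module if every submodule $N$ of $M$ has the form $N=IM$ for some ideal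 $I$ of $R$ (equivalently $N=(N:M)M$). *)

theory Defs
  imports "HOL-Analysis.Abstract_Topology" "HOL-Algebra.Ideal" "HOL-Algebra.Module"
begin

definition module_colon ::
    "('a, 'c) ring_scheme \<Rightarrow> ('a, 'b, 'd) module_scheme \<Rightarrow> 'b set \<Rightarrow> 'a set"
  where "module_colon R M N = {r \<in> carrier R. \<forall>m \<in> carrier M. r \<odot>\<^bsub>M\<^esub> m \<in> N}"

definition prime_submodule ::
    "('a, 'c) ring_scheme \<Rightarrow> ('a, 'b, 'd) module_scheme \<Rightarrow> 'b set \<Rightarrow> bool"
  where "prime_submodule R M P \<longleftrightarrow>
    submodule P R M \<and> P \<noteq> carrier M \<and>
    (\<forall>r \<in> carrier R. \<forall>m \<in> carrier M. r \<odot>\<^bsub>M\<^esub> m \<in> P \<longrightarrow> m \<in> P \<or> r \<in> module_colon R M P)"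

definition module_Spec ::
    "('a, 'c) ring_scheme \<Rightarrow> ('a, 'b, 'd) module_scheme \<Rightarrow> 'b set set"
  where "module_Spec R M = {P. prime_submodule R M P}"

definition mult_closed :: "('a, 'c) ring_scheme \<Rightarrow> 'a set \<Rightarrow> bool"
  where "mult_closed R T \<longleftrightarrow>
    T \<subseteq> carrier R \<and> \<one>\<^bsub>R\<^esub> \<in> T \<and> (\<forall>x \<in> T. \<forall>y \<in> T. x \<otimes>\<^bsub>R\<^esub> y \<in> T)"

text \<open>The closed set attached to a family of multiplicatively closed sets depends only on
  the set of its members, so families are represented by sets of sets; they may be empty
  or infinite.\<close>

definition V_tilde ::
    "('a, 'c) ring_scheme \<Rightarrow> ('a, 'b, 'd) module_scheme \<Rightarrow> 'a set set \<Rightarrow> 'b set set"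
  where "V_tilde R M \<S> = {P \<in> module_Spec R M. \<forall>S \<in> \<S>. module_colon R M P \<inter> S \<noteq> {}}"

text \<open>The function \<^const>\<open>topology\<close> is only meaningful on predicates satisfying
  \<^const>\<open>istopology\<close>; that this is the case, and that the closed sets are exactly the
  sets \<open>V_tilde R M \<S>\<close>, is proved below.\<close>

definition Spec_tilde ::
    "('a, 'c) ring_scheme \<Rightarrow> ('a, 'b, 'd) module_scheme \<Rightarrow> 'b set topology"
  where "Spec_tilde R M =
    topology (\<lambda>U. \<exists>\<S>. (\<forall>S \<in> \<S>. mult_closed R S) \<and> U = module_Spec R M - V_tilde R M \<S>)"

definition connected_relation :: "('a \<Rightarrow> 'a \<Rightarrow> bool) \<Rightarrow> 'a set \<Rightarrow> bool"
  where "connected_relation r X \<longleftrightarrow>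
    (\<forall>x \<in> X. \<forall>y \<in> X. \<exists>xs. xs \<noteq> [] \<and> set xs \<subseteq> X \<and> hd xs = x \<and> last xs = y \<and>
      (\<forall>i. 1 \<le> i \<and> i < length xs \<longrightarrow> r (xs ! (i - 1)) (xs ! i) \<or> r (xs ! i) (xs ! (i - 1))))"

definition ideal_smult ::
    "('a, 'b, 'd) module_scheme \<Rightarrow> 'a set \<Rightarrow> 'b set"
  where "ideal_smult M I =
    {(\<Oplus>\<^bsub>M\<^esub> k \<in> {..<n}. a k \<odot>\<^bsub>M\<^esub> x k) | (n::nat) a x.
      a \<in> {..<n} \<rightarrow> I \<and> x \<in> {..<n} \<rightarrow> carrier M}"

definition multiplication_module ::
    "('a, 'c) ring_scheme \<Rightarrow> ('a, 'b, 'd) module_scheme \<Rightarrow> bool"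
  where "multiplication_module R M \<longleftrightarrow>
    (\<forall>N. submodule N R M \<longrightarrow> (\<exists>I. ideal I R \<and> N = ideal_smult M I))"

lemma one_notin_module_colon:
  assumes "Module.module R M" "P \<in> module_Spec R M"
  shows "\<one>\<^bsub>R\<^esub> \<notin> module_colon R M P"
proof
  assume "\<one>\<^bsub>R\<^esub> \<in> module_colon R M P"
  then have "carrier M \<subseteq> P"
    using Module.module.smult_one[OF assms(1)] by (auto simp: module_colon_def)
  moreover have "P \<subseteq> carrier M" "P \<noteq> carrier M"
    using assms Module.module.submoduleE(1)[OF assms(1)]
    by (auto simp: module_Spec_def prime_submodule_def)
  ultimately show False by blast
qed

lemma module_colon_mult_iff:
  assumes M: "Module.module R M" and P: "P \<in> module_Spec R M"
    and r: "r \<in> carrier R" "s \<in> carrier R"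
  shows "r \<otimes>\<^bsub>R\<^esub> s \<in> module_colon R M P \<longleftrightarrow>
    r \<in> module_colon R M P \<or> s \<in> module_colon R M P"
proof -
  interpret Module.module R M by fact
  have sub: "submodule P R M"
    and prime: "\<And>r m. r \<in> carrier R \<Longrightarrow> m \<in> carrier M \<Longrightarrow> r \<odot>\<^bsub>M\<^esub> m \<in> P \<Longrightarrow>
      m \<in> P \<or> r \<in> module_colon R M P"
    using P by (auto simp: module_Spec_def prime_submodule_def)
  have PM: "P \<subseteq> carrier M" using submoduleE(1)[OF sub] .
  show ?thesis
  proof
    assume a: "r \<otimes>\<^bsub>R\<^esub> s \<in> module_colon R M P"
    show "r \<in> module_colon R M P \<or> s \<in> module_colon R M P"
    proof (rule disjCI)
      assume s: "s \<notin> module_colon R M P"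
      then obtain m where m: "m \<in> carrier M" "s \<odot>\<^bsub>M\<^esub> m \<notin> P"
        using r by (auto simp: module_colon_def)
      have "r \<odot>\<^bsub>M\<^esub> (s \<odot>\<^bsub>M\<^esub> m) \<in> P"
        using a m(1) r smult_assoc1[of r s m] by (auto simp: module_colon_def)
      then show "r \<in> module_colon R M P"
        using prime[of r "s \<odot>\<^bsub>M\<^esub> m"] m r by auto
    qed
  next
    assume "r \<in> module_colon R M P \<or> s \<in> module_colon R M P"
    then show "r \<otimes>\<^bsub>R\<^esub> s \<in> module_colon R M P"
      using r submoduleE(4)[OF sub] by (auto simp: module_colon_def smult_assoc1)
  qed
qed

lemma V_tilde_Union: "V_tilde R M (\<Union>\<F>) = module_Spec R M \<inter> (\<Inter>\<S> \<in> \<F>. V_tilde R M \<S>)"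
  by (auto simp: V_tilde_def)

lemma V_tilde_Un:
  assumes M: "Module.module R M"
    and S: "\<forall>S \<in> \<S>. mult_closed R S" and T: "\<forall>T \<in> \<T>. mult_closed R T"
  shows "\<exists>\<U>. (\<forall>U \<in> \<U>. mult_closed R U) \<and> V_tilde R M \<U> = V_tilde R M \<S> \<union> V_tilde R M \<T>"
proof -
  interpret Module.module R M by fact
  define m where "m = (\<lambda>S T. {s \<otimes>\<^bsub>R\<^esub> t | s t. s \<in> S \<and> t \<in> T})"
  have mc: "mult_closed R (m S T)" if "mult_closed R S" "mult_closed R T" for S T
    unfolding mult_closed_def
  proof (intro conjI ballI)
    show "m S T \<subseteq> carrier R" using that by (auto simp: m_def mult_closed_def)
    have "\<one>\<^bsub>R\<^esub> = \<one>\<^bsub>R\<^esub> \<otimes>\<^bsub>R\<^esub> \<one>\<^bsub>R\<^esub>" by simp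
    then show "\<one>\<^bsub>R\<^esub> \<in> m S T" using that unfolding m_def mult_closed_def by blast
  next
    fix x y assume "x \<in> m S T" "y \<in> m S T"
    then obtain s t s' t' where st: "x = s \<otimes>\<^bsub>R\<^esub> t" "y = s' \<otimes>\<^bsub>R\<^esub> t'"
      "s \<in> S" "t \<in> T" "s' \<in> S" "t' \<in> T" by (auto simp: m_def)
    moreover have "s \<in> carrier R" "t \<in> carrier R" "s' \<in> carrier R" "t' \<in> carrier R"
      using st that by (auto simp: mult_closed_def)
    ultimately have "x \<otimes>\<^bsub>R\<^esub> y = (s \<otimes>\<^bsub>R\<^esub> s') \<otimes>\<^bsub>R\<^esub> (t \<otimes>\<^bsub>R\<^esub> t')"
      by (simp add: R.m_ac)
    moreover have "s \<otimes>\<^bsub>R\<^esub> s' \<in> S" "t \<otimes>\<^bsub>R\<^esub> t' \<in> T"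
      using st that by (auto simp: mult_closed_def)
    ultimately show "x \<otimes>\<^bsub>R\<^esub> y \<in> m S T" by (auto simp: m_def)
  qed
  have meet: "module_colon R M P \<inter> m S T \<noteq> {} \<longleftrightarrow>
      module_colon R M P \<inter> S \<noteq> {} \<or> module_colon R M P \<inter> T \<noteq> {}"
    if P: "P \<in> module_Spec R M" and c: "mult_closed R S" "mult_closed R T" for P S T
  proof -
    have sub: "S \<subseteq> carrier R" "T \<subseteq> carrier R" "\<one>\<^bsub>R\<^esub> \<in> S" "\<one>\<^bsub>R\<^esub> \<in> T"
      using c by (auto simp: mult_closed_def)
    have "module_colon R M P \<inter> m S T \<noteq> {} \<longleftrightarrow>
        (\<exists>s \<in> S. \<exists>t \<in> T. s \<otimes>\<^bsub>R\<^esub> t \<in> module_colon R M P)"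
      by (auto simp: m_def)
    also have "\<dots> \<longleftrightarrow> (\<exists>s \<in> S. \<exists>t \<in> T. s \<in> module_colon R M P \<or> t \<in> module_colon R M P)"
      using module_colon_mult_iff[OF M P] sub by (meson subsetD)
    also have "\<dots> \<longleftrightarrow> module_colon R M P \<inter> S \<noteq> {} \<or> module_colon R M P \<inter> T \<noteq> {}"
      using sub by blast
    finally show ?thesis .
  qed
  have "V_tilde R M {m S T | S T. S \<in> \<S> \<and> T \<in> \<T>} = V_tilde R M \<S> \<union> V_tilde R M \<T>"
  proof (rule Set.set_eqI)
    fix P
    show "P \<in> V_tilde R M {m S T | S T. S \<in> \<S> \<and> T \<in> \<T>} \<longleftrightarrow>
        P \<in> V_tilde R M \<S> \<union> V_tilde R M \<T>"
    proof (cases "P \<in> module_Spec R M")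
      case True
      then have "P \<in> V_tilde R M {m S T | S T. S \<in> \<S> \<and> T \<in> \<T>} \<longleftrightarrow>
          (\<forall>S \<in> \<S>. \<forall>T \<in> \<T>. module_colon R M P \<inter> m S T \<noteq> {})"
        by (auto simp: V_tilde_def)
      also have "\<dots> \<longleftrightarrow> (\<forall>S \<in> \<S>. \<forall>T \<in> \<T>.
          module_colon R M P \<inter> S \<noteq> {} \<or> module_colon R M P \<inter> T \<noteq> {})"
        using meet[OF True] S T by simp
      also have "\<dots> \<longleftrightarrow> P \<in> V_tilde R M \<S> \<union> V_tilde R M \<T>"
        using True unfolding V_tilde_def by blast
      finally show ?thesis .
    qed (auto simp: V_tilde_def)
  qed
  then show ?thesis
    using mc S T by (intro exI[of _ "{m S T | S T. S \<in> \<S> \<and> T \<in> \<T>}"]) auto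
qed

lemma istopology_Spec_tilde:
  assumes M: "Module.module R M"
  shows "istopology
    (\<lambda>U. \<exists>\<S>. (\<forall>S \<in> \<S>. mult_closed R S) \<and> U = module_Spec R M - V_tilde R M \<S>)"
  unfolding istopology_def
proof (intro conjI allI impI)
  fix U V
  assume "\<exists>\<S>. (\<forall>S \<in> \<S>. mult_closed R S) \<and> U = module_Spec R M - V_tilde R M \<S>"
    and "\<exists>\<S>. (\<forall>S \<in> \<S>. mult_closed R S) \<and> V = module_Spec R M - V_tilde R M \<S>"
  then obtain \<S> \<T> where st: "\<forall>S \<in> \<S>. mult_closed R S" "\<forall>S \<in> \<T>. mult_closed R S"
    "U = module_Spec R M - V_tilde R M \<S>" "V = module_Spec R M - V_tilde R M \<T>" by blast
  obtain \<U> where u: "\<forall>U \<in> \<U>. mult_closed R U"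
      "V_tilde R M \<U> = V_tilde R M \<S> \<union> V_tilde R M \<T>"
    using V_tilde_Un[OF M st(1,2)] by blast
  then have "U \<inter> V = module_Spec R M - V_tilde R M \<U>" using st by blast
  then show "\<exists>\<S>. (\<forall>S \<in> \<S>. mult_closed R S) \<and> U \<inter> V = module_Spec R M - V_tilde R M \<S>"
    using u by blast
next
  fix \<K>
  assume "\<forall>K \<in> \<K>. \<exists>\<S>. (\<forall>S \<in> \<S>. mult_closed R S) \<and> K = module_Spec R M - V_tilde R M \<S>"
  then obtain f where f: "\<And>K S. K \<in> \<K> \<Longrightarrow> S \<in> f K \<Longrightarrow> mult_closed R S"
    "\<And>K. K \<in> \<K> \<Longrightarrow> K = module_Spec R M - V_tilde R M (f K)" by metis
  show "\<exists>\<S>. (\<forall>S \<in> \<S>. mult_closed R S) \<and> \<Union>\<K> = module_Spec R M - V_tilde R M \<S>"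
  proof (intro exI conjI)
    show "\<forall>S \<in> \<Union>(f ` \<K>). mult_closed R S" using f(1) by blast
    have "\<Union>\<K> = (\<Union>K \<in> \<K>. module_Spec R M - V_tilde R M (f K))"
      using f(2) by auto
    then show "\<Union>\<K> = module_Spec R M - V_tilde R M (\<Union>(f ` \<K>))"
      unfolding V_tilde_Union by auto
  qed
qed

lemma topspace_Spec_tilde:
  assumes M: "Module.module R M"
  shows "topspace (Spec_tilde R M) = module_Spec R M"
proof -
  interpret Module.module R M by fact
  have "mult_closed R {\<one>\<^bsub>R\<^esub>}" by (simp add: mult_closed_def)
  moreover have "V_tilde R M {{\<one>\<^bsub>R\<^esub>}} = {}"
    using one_notin_module_colon[OF M] by (auto simp: V_tilde_def)
  ultimately have "openin (Spec_tilde R M) (module_Spec R M)"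
    unfolding Spec_tilde_def topology_inverse'[OF istopology_Spec_tilde[OF M]]
    by (intro exI[of _ "{{\<one>\<^bsub>R\<^esub>}}"]) simp
  moreover have "U \<subseteq> module_Spec R M" if "openin (Spec_tilde R M) U" for U
    using that unfolding Spec_tilde_def topology_inverse'[OF istopology_Spec_tilde[OF M]]
    by blast
  ultimately show ?thesis
    by (meson openin_subset openin_topspace subset_antisym)
qed

lemma closedin_Spec_tilde:
  assumes M: "Module.module R M"
  shows "closedin (Spec_tilde R M) C \<longleftrightarrow>
    (\<exists>\<S>. (\<forall>S \<in> \<S>. mult_closed R S) \<and> C = V_tilde R M \<S>)"
proof -
  have V: "V_tilde R M \<S> \<subseteq> module_Spec R M" for \<S> by (auto simp: V_tilde_def)
  have "closedin (Spec_tilde R M) C \<longleftrightarrow> C \<subseteq> module_Spec R M \<and>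
      (\<exists>\<S>. (\<forall>S \<in> \<S>. mult_closed R S) \<and>
        module_Spec R M - C = module_Spec R M - V_tilde R M \<S>)"
    unfolding closedin_def topspace_Spec_tilde[OF M]
    unfolding Spec_tilde_def topology_inverse'[OF istopology_Spec_tilde[OF M]] ..
  also have "\<dots> \<longleftrightarrow> (\<exists>\<S>. (\<forall>S \<in> \<S>. mult_closed R S) \<and> C = V_tilde R M \<S>)"
    using V by (metis double_diff subset_refl)
  finally show ?thesis .
qed

end

theory Submission
  imports Defs
begin

text \<open>The topology on \<open>Spec(M)\<close> is an Alexandrov topology: taking \<open>S = R - (P : M)\<close> one sees that
  \<open>{Q. (Q : M) \<subseteq> (P : M)}\<close> is the smallest open neighbourhood of \<open>P\<close>, so the clopen sets are those
  that are saturated for the relation \<open>(Q : M) \<subseteq> (P : M)\<close>. Inclusion always refines this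
  relation, and agrees with it for multiplication modules, where \<open>P = (P : M) M\<close>.\<close>

text \<open>Chains are traded for saturated sets in order to match the clopen sets of a topology. A
  saturated set absorbs every chain that starts in it; conversely, the endpoints of chains from a
  fixed point form a saturated set.\<close>

lemma connected_relation_iff_saturated:
  "connected_relation r X \<longleftrightarrow>
    (\<forall>A. A \<subseteq> X \<and> A \<noteq> {} \<and> (\<forall>x \<in> X. \<forall>y \<in> X. r x y \<longrightarrow> (x \<in> A \<longleftrightarrow> y \<in> A)) \<longrightarrow> A = X)"
  (is "_ \<longleftrightarrow> ?sat")
proof
  assume conn: "connected_relation r X"
  show ?sat
  proof (intro allI impI subset_antisym; elim conjE)
    fix A assume A: "A \<subseteq> X" "A \<noteq> {}" "\<forall>x \<in> X. \<forall>y \<in> X. r x y \<longrightarrow> (x \<in> A \<longleftrightarrow> y \<in> A)"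
    obtain x where x: "x \<in> A" using A by blast
    show "X \<subseteq> A"
    proof
      fix y assume "y \<in> X"
      then obtain xs where xs: "xs \<noteq> []" "set xs \<subseteq> X" "hd xs = x" "last xs = y"
        "\<And>i. 1 \<le> i \<Longrightarrow> i < length xs \<Longrightarrow> r (xs ! (i - 1)) (xs ! i) \<or> r (xs ! i) (xs ! (i - 1))"
        using conn x A(1) unfolding connected_relation_def by (meson subsetD)
      \<comment> \<open>Saturation is an equivalence of memberships, so each link may point either
        way.\<close>
      have "i < length xs \<Longrightarrow> xs ! i \<in> A" for i
      proof (induction i)
        case 0
        then show ?case using xs x by (simp add: hd_conv_nth)
      next
        case (Suc i)
        then have "xs ! i \<in> X" "xs ! Suc i \<in> X" using xs(2) by (auto simp: subset_iff)
        then show ?case using Suc xs(5)[of "Suc i"] A(3) by auto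
      qed
      then show "y \<in> A" using xs(1,4) by (metis diff_less last_conv_nth length_greater_0_conv zero_less_one)
    qed
  qed
next
  assume sat: ?sat
  show "connected_relation r X"
    unfolding connected_relation_def
  proof (intro ballI)
    fix x y assume x: "x \<in> X" and y: "y \<in> X"
    \<comment> \<open>The end of a chain is left free, so that \<open>A\<close> collects all points
      reachable from \<open>x\<close>.\<close>
    define chain where "chain = (\<lambda>xs. xs \<noteq> [] \<and> set xs \<subseteq> X \<and> hd xs = x \<and>
      (\<forall>i. 1 \<le> i \<and> i < length xs \<longrightarrow> r (xs ! (i - 1)) (xs ! i) \<or> r (xs ! i) (xs ! (i - 1))))"
    define A where "A = last ` Collect chain"
    have A_sub: "A \<subseteq> X"
      by (auto simp: A_def chain_def)
    have "chain [x]" using x by (simp add: chain_def)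
    then have x_in: "x \<in> A" unfolding A_def by force
    have step: "v \<in> A" if "u \<in> A" "v \<in> X" "r u v \<or> r v u" for u v
    proof -
      obtain xs where xs: "chain xs" "u = last xs" using \<open>u \<in> A\<close> by (auto simp: A_def)
      have "chain (xs @ [v])"
        unfolding chain_def
      proof (intro conjI allI impI)
        show "set (xs @ [v]) \<subseteq> X" "hd (xs @ [v]) = x"
          using xs that by (auto simp: chain_def)
      next
        fix i assume i: "1 \<le> i \<and> i < length (xs @ [v])"
        show "r ((xs @ [v]) ! (i - 1)) ((xs @ [v]) ! i) \<or> r ((xs @ [v]) ! i) ((xs @ [v]) ! (i - 1))"
        \<comment> \<open>The only new link joins \<open>last xs\<close>, at index
          \<open>length xs - 1\<close>, to \<open>v\<close>.\<close>
        proof (cases "i = length xs")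
          case True
          then show ?thesis using xs that(3) i
            by (auto simp: nth_append chain_def last_conv_nth)
        next
          case False
          then have "i < length xs" "i - 1 < length xs" using i by auto
          then show ?thesis using xs i by (simp add: nth_append chain_def)
        qed
      qed simp
      then show ?thesis unfolding A_def by force
    qed
    have "A = X"
      using sat A_sub x_in step by blast
    then obtain xs where "chain xs" "last xs = y" using y by (auto simp: A_def)
    then show "\<exists>xs. xs \<noteq> [] \<and> set xs \<subseteq> X \<and> hd xs = x \<and> last xs = y \<and>
        (\<forall>i. 1 \<le> i \<and> i < length xs \<longrightarrow> r (xs ! (i - 1)) (xs ! i) \<or> r (xs ! i) (xs ! (i - 1)))"
      unfolding chain_def by blast
  qed
qed

text \<open>On \<open>X\<close>, every set saturated for the larger relation \<open>s\<close> is
  also saturated for \<open>r\<close>.\<close>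

lemma connected_relation_mono:
  assumes conn: "connected_relation r X"
    and imp: "\<And>x y. x \<in> X \<Longrightarrow> y \<in> X \<Longrightarrow> r x y \<Longrightarrow> s x y"
  shows "connected_relation s X"
  unfolding connected_relation_iff_saturated
proof (intro allI impI; elim conjE)
  fix A assume A: "A \<subseteq> X" "A \<noteq> {}"
    and sat: "\<forall>x \<in> X. \<forall>y \<in> X. s x y \<longrightarrow> (x \<in> A \<longleftrightarrow> y \<in> A)"
  have "\<forall>x \<in> X. \<forall>y \<in> X. r x y \<longrightarrow> (x \<in> A \<longleftrightarrow> y \<in> A)"
    using sat imp by blast
  with conn A show "A = X" unfolding connected_relation_iff_saturated by blast
qed

text \<open>This is the complement of the prime ideal \<open>(P : M)\<close>. Such sets cut out the
  smallest open neighbourhoods.\<close>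

lemma mult_closed_compl_module_colon:
  assumes M: "Module.module R M" and P: "P \<in> module_Spec R M"
  shows "mult_closed R (carrier R - module_colon R M P)"
proof -
  interpret Module.module R M by fact
  show ?thesis
    using one_notin_module_colon[OF M P] module_colon_mult_iff[OF M P]
    by (auto simp: mult_closed_def)
qed

lemma openin_Spec_tilde_iff:
  assumes M: "Module.module R M"
  shows "openin (Spec_tilde R M) U \<longleftrightarrow> U \<subseteq> module_Spec R M \<and>
    (\<forall>P \<in> U. \<forall>Q \<in> module_Spec R M. module_colon R M Q \<subseteq> module_colon R M P \<longrightarrow> Q \<in> U)"
    (is "_ \<longleftrightarrow> _ \<and> ?down")
proof (intro iffI conjI)
  assume U: "openin (Spec_tilde R M) U"
  then show "U \<subseteq> module_Spec R M"
    using openin_subset topspace_Spec_tilde[OF M] by metis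
  obtain \<S> where "U = module_Spec R M - V_tilde R M \<S>"
    using U unfolding Spec_tilde_def topology_inverse'[OF istopology_Spec_tilde[OF M]] by blast
  \<comment> \<open>A point of \<open>U\<close> has a colon missing some \<open>S\<close> in the
    family, and then every smaller colon misses the same \<open>S\<close>.\<close>
  then show ?down unfolding V_tilde_def by blast
next
  assume "U \<subseteq> module_Spec R M \<and> ?down"
  then have sub: "U \<subseteq> module_Spec R M" and down: ?down by auto
  \<comment> \<open>One set is taken for each point of \<open>U\<close>. Since
    \<open>(Q : M)\<close> misses the set of \<open>P\<close> exactly when \<open>(Q : M)\<close>
    lies in \<open>(P : M)\<close>, the points outside \<open>V_tilde R M \<S>\<close> are those
    below some point of \<open>U\<close>; by \<open>?down\<close> they are the points of
    \<open>U\<close>.\<close>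
  define \<S> where "\<S> = (\<lambda>P. carrier R - module_colon R M P) ` U"
  have "\<forall>S \<in> \<S>. mult_closed R S"
    using mult_closed_compl_module_colon[OF M] sub by (auto simp: \<S>_def)
  moreover have "U = module_Spec R M - V_tilde R M \<S>"
  proof -
    have "module_colon R M Q \<inter> (carrier R - module_colon R M P) = {} \<longleftrightarrow>
        module_colon R M Q \<subseteq> module_colon R M P" for P Q
      by (auto simp: module_colon_def)
    then show ?thesis using sub down by (auto simp: \<S>_def V_tilde_def)
  qed
  ultimately show "openin (Spec_tilde R M) U"
    unfolding Spec_tilde_def topology_inverse'[OF istopology_Spec_tilde[OF M]] by blast
qed

text \<open>A clopen set is closed downwards, and so is its complement, which makes the set closed
  upwards as well. Together this is saturation, so both sides quantify over the same sets.\<close>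

lemma connected_space_Spec_tilde_iff:
  assumes M: "Module.module R M"
  shows "connected_space (Spec_tilde R M) \<longleftrightarrow>
    connected_relation (\<lambda>P Q. module_colon R M P \<subseteq> module_colon R M Q) (module_Spec R M)"
  unfolding connected_space_clopen_in connected_relation_iff_saturated closedin_def
    topspace_Spec_tilde[OF M] openin_Spec_tilde_iff[OF M]
  by (intro all_cong1) blast

lemma module_colon_mono: "P \<subseteq> Q \<Longrightarrow> module_colon R M P \<subseteq> module_colon R M Q"
  by (auto simp: module_colon_def)

text \<open>This is the inclusion of \<open>(Q : M) M\<close> in \<open>Q\<close>, phrased for the
  sums that make up \<open>ideal_smult\<close>.\<close>

lemma finsum_smult_mem_submodule:
  fixes x :: "nat \<Rightarrow> 'b"
  assumes M: "Module.module R M" and Q: "submodule Q R M"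
    and a: "a \<in> {..<n} \<rightarrow> module_colon R M Q" and x: "x \<in> {..<n} \<rightarrow> carrier M"
  shows "(\<Oplus>\<^bsub>M\<^esub> k \<in> {..<n}. a k \<odot>\<^bsub>M\<^esub> x k) \<in> Q"
proof -
  interpret Module.module R M by fact
  have term_mem: "a k \<odot>\<^bsub>M\<^esub> x k \<in> Q" if "k < n" for k
    using that a x by (auto simp: module_colon_def Pi_iff)
  have QM: "Q \<subseteq> carrier M" using submoduleE(1)[OF Q] .
  \<comment> \<open>The bound stays inside the induction because \<open>a\<close> and
    \<open>x\<close> are controlled only below \<open>n\<close>.\<close>
  have "m \<le> n \<Longrightarrow> (\<Oplus>\<^bsub>M\<^esub> k \<in> {..<m}. a k \<odot>\<^bsub>M\<^esub> x k) \<in> Q" for m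
  proof (induction m)
    case 0
    then show ?case using subgroup.one_closed[OF submodule.axioms(1)[OF Q]] by simp
  next
    case (Suc m)
    have "(\<lambda>k. a k \<odot>\<^bsub>M\<^esub> x k) \<in> {..<m} \<rightarrow> carrier M" "a m \<odot>\<^bsub>M\<^esub> x m \<in> carrier M"
      using term_mem QM Suc.prems by auto
    then have "(\<Oplus>\<^bsub>M\<^esub> k \<in> {..<Suc m}. a k \<odot>\<^bsub>M\<^esub> x k) =
        a m \<odot>\<^bsub>M\<^esub> x m \<oplus>\<^bsub>M\<^esub> (\<Oplus>\<^bsub>M\<^esub> k \<in> {..<m}. a k \<odot>\<^bsub>M\<^esub> x k)"
      by (simp add: lessThan_Suc)
    then show ?case using Suc term_mem[of m] submoduleE(5)[OF Q] by simp
  qed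
  then show ?thesis by simp
qed

text \<open>A single product is a sum of length one. The lemma serves to show that \<open>I\<close>
  lies in \<open>(IM : M)\<close>.\<close>

lemma smult_mem_ideal_smult:
  assumes M: "Module.module R M" and I: "ideal I R"
    and r: "r \<in> I" and m: "m \<in> carrier M"
  shows "r \<odot>\<^bsub>M\<^esub> m \<in> ideal_smult M I"
proof -
  interpret Module.module R M by fact
  have "r \<in> carrier R" using ideal.Icarr[OF I r] .
  then have "r \<odot>\<^bsub>M\<^esub> m = (\<Oplus>\<^bsub>M\<^esub> k \<in> {..<1::nat}. r \<odot>\<^bsub>M\<^esub> m)"
    using m by (simp add: lessThan_Suc)
  then show ?thesis
    using r m unfolding ideal_smult_def
    by (intro CollectI exI[of _ 1] exI[of _ "\<lambda>_. r"] exI[of _ "\<lambda>_. m"]) auto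
qed

text \<open>Write \<open>P = IM\<close>. Then \<open>I\<close> lies in \<open>(P : M)\<close>, hence
  in \<open>(Q : M)\<close>, so \<open>P = IM\<close> lies in \<open>(Q : M) M\<close> and therefore
  in \<open>Q\<close>.\<close>

lemma module_colon_subset_iff:
  assumes M: "Module.module R M" and mult: "multiplication_module R M"
    and P: "submodule P R M" and Q: "submodule Q R M"
  shows "module_colon R M P \<subseteq> module_colon R M Q \<longleftrightarrow> P \<subseteq> Q"
proof
  assume colon: "module_colon R M P \<subseteq> module_colon R M Q"
  obtain I where I: "ideal I R" "P = ideal_smult M I"
    using mult P by (auto simp: multiplication_module_def)
  have "I \<subseteq> module_colon R M P"
    using smult_mem_ideal_smult[OF M I(1)] ideal.Icarr[OF I(1)] I(2)
    by (auto simp: module_colon_def)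
  then have IQ: "I \<subseteq> module_colon R M Q" using colon by blast
  show "P \<subseteq> Q"
  proof
    fix p assume "p \<in> P"
    then obtain n :: nat and a x where "p = (\<Oplus>\<^bsub>M\<^esub> k \<in> {..<n}. a k \<odot>\<^bsub>M\<^esub> x k)"
      "a \<in> {..<n} \<rightarrow> I" "x \<in> {..<n} \<rightarrow> carrier M"
      unfolding I(2) ideal_smult_def by blast
    then show "p \<in> Q"
      using finsum_smult_mem_submodule[OF M Q, of a n x] IQ by auto
  qed
qed (rule module_colon_mono)

theorem theorem6:
  fixes R :: "('a, 'c) ring_scheme" and M :: "('a, 'b, 'd) module_scheme"
  assumes "Module.module R M"
    and "module_Spec R M \<noteq> {}"
  shows "(connected_relation (\<subseteq>) (module_Spec R M) \<longrightarrow> connected_space (Spec_tilde R M)) \<and>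
    (multiplication_module R M \<longrightarrow>
      connected_space (Spec_tilde R M) \<longrightarrow> connected_relation (\<subseteq>) (module_Spec R M))"
proof (intro conjI impI)
  assume "connected_relation (\<subseteq>) (module_Spec R M)"
  then show "connected_space (Spec_tilde R M)"
    unfolding connected_space_Spec_tilde_iff[OF assms(1)]
    by (rule connected_relation_mono) (rule module_colon_mono)
next
  assume mult: "multiplication_module R M" and "connected_space (Spec_tilde R M)"
  then have "connected_relation (\<lambda>P Q. module_colon R M P \<subseteq> module_colon R M Q) (module_Spec R M)"
    using connected_space_Spec_tilde_iff[OF assms(1)] by blast
  then show "connected_relation (\<subseteq>) (module_Spec R M)"
  \<comment> \<open>For a multiplication module, comparable colons come from comparable submodules,
    so connectedness passes back to inclusion.\<close>
  proof (rule connected_relation_mono)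
    fix P Q assume "P \<in> module_Spec R M" "Q \<in> module_Spec R M"
      "module_colon R M P \<subseteq> module_colon R M Q"
    then show "P \<subseteq> Q"
      using module_colon_subset_iff[OF assms(1) mult]
      by (simp add: module_Spec_def prime_submodule_def)
  qed
qed

end
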